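(* For every $i\in\mathbb{Z}_4$, the following two relations hold on every nonzero finite-dimensional $\square_q$-module $V$ (i.e. as equalities in $\mathrm{End}(V)$): $$\exp_q(\mathfrak{n}_{i,i+1})\,x_{i}\,\exp_q(\mathfrak{n}_{i,i+1})^{-1}=x_{i+1}^{-1},$$ $$\exp_q(\mathfrak{n}_{i,i+1})^{-1}\,x_{i+1}\,\exp_q(\mathfrak{n}_{i,i+1})=x_i^{-1}.$$
   Context: Let $\mathbb{F}$ be an algebraically closed field and let $0\ne q\in\mathbb{F}$ be not a root of unity. Algebras are associative with $1$. For $n\in\mathbb{Z}$, $[n]_q=(q^n-q^{-n})/(q-q^{-1})$; for $n\in\mathbb{N}=\{0,1,2,\dots\}$, $[n]_q^!=\prod_{k=1}^n[k]_q$ with $[0]_q^!=1$. Let $\mathbb{Z}_4=\mathbb{Z}/4\mathbb{Z}$; indices are taken in $\mathbb{Z}_4$. $\square_q$ is the $\mathbb{F}$-algebra with generators $\{x_i\}_{i\in\mathbb{Z}_4}$ and relations, for $i\in\mathbb{Z}_4$, $$\frac{qx_ix_{i+1}-q^{-1}x_{i+1}x_i}{q-q^{-1}}=1,\qquad x_i^3x_{i+2}-[3]_qx_i^2x_{i+2}x_i+[3]_qx_ix_{i+2}x_i^2-x_{i+2}x_i^3=0.$$ For $i\in\mathbb{Z}_4$ put $\mathfrak{n}_{i,i+1}=\dfrac{q(1-x_ix_{i+1})}{q-q^{-1}}=\dfrac{q^{-1}(1-x_{i+1}x_i)}{q-q^{-1}}\in\square_q$. On every nonzero finite-dimensional $\square_q$-module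 each $x_i$ acts invertibly, and $x_i^{-1}$ denotes the inverse of that action; each $\mathfrak{n}_{i,i+1}$ acts nilpotently. For a nilpotent $\psi\in\mathrm{End}(V)$, $V$ a nonzero finite-dimensional $\mathbb{F}$-vector space, $\exp_q(\psi)=\sum_{n\in\mathbb{N}}\frac{q^{\binom n2}}{[n]_q^!}\psi^n$, which is invertible. *)

theory Defs
  imports
    "HOL-Library.Poly_Mapping"
    "HOL-Library.Numeral_Type"
    "HOL-Computational_Algebra.Polynomial"
    "HOL-Algebra.QuotRing"
    "HOL-Algebra.Algebraic_Closure_Type"
begin

section \<open>Free associative algebras\<close>

datatype 'x word = Word (letters: "'x list")

instantiation word :: (type) monoid_add
begin
definition zero_word :: "'a word" where "0 = Word []"
definition plus_word :: "'a word \<Rightarrow> 'a word \<Rightarrow> 'a word"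
  where "u + v = Word (letters u @ letters v)"
instance by standard (auto simp: zero_word_def plus_word_def)
end

text \<open>
  The free associative algebra with basis the words: the product of
  \<^typ>\<open>'x word \<Rightarrow>\<^sub>0 'a\<close> is convolution, which here is concatenation of words, extended
  bilinearly. It is not commutative.
\<close>

type_synonym ('x, 'a) free_alg = "'x word \<Rightarrow>\<^sub>0 'a"

definition gen :: "'x \<Rightarrow> ('x, 'a::field) free_alg"
  where "gen x = Poly_Mapping.single (Word [x]) 1"

definition const :: "'a::field \<Rightarrow> ('x, 'a) free_alg"
  where "const c = Poly_Mapping.single 0 c"

lemma const_add: "const (a + b) = const a + const b"
  and const_diff: "const (a - b) = const a - const b"
  and const_mult: "const (a * b) = const a * const b"
  and const_one: "const 1 = 1"
  by (simp_all add: const_def single_add single_diff mult_single)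

lemma const_commute: "const c * p = p * const c"
proof (induction p rule: update_induct)
  case const
  then show ?case by simp
next
  case (update p k v)
  have "Poly_Mapping.update k v p = p + Poly_Mapping.single k v"
    using update(1) by (intro poly_mapping_eqI)
      (auto simp: lookup_update lookup_add lookup_single when_def in_keys_iff)
  moreover have "const c * Poly_Mapping.single k v = Poly_Mapping.single k v * const c"
    by (simp add: const_def mult_single mult.commute)
  ultimately show ?case using update by (simp add: algebra_simps)
qed

abbreviation free_ring :: "('x, 'a::field) free_alg ring"
  where "free_ring \<equiv> ring_of_type_algebra"

lemma carrier_free_ring [simp]: "carrier free_ring = UNIV"
  by (simp add: ring_of_type_algebra_def)

lemma ring_free_ring: "ring (free_ring :: ('x, 'a::field) free_alg ring)"
proof -
  have "\<exists>y. x + y = 0" for x :: "('x, 'a) free_alg"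
    using add.right_inverse by blast
  then show ?thesis
    unfolding ring_of_type_algebra_def using add.right_inverse
    by unfold_locales (auto simp: algebra_simps Units_def)
qed


section \<open>Quantum integers and the algebra \<open>\<square>\<^sub>q\<close>\<close>

definition qint :: "'a::field \<Rightarrow> int \<Rightarrow> 'a"
  where "qint q n = (q powi n - q powi (- n)) / (q - inverse q)"

definition qfact :: "'a::field \<Rightarrow> nat \<Rightarrow> 'a"
  where "qfact q n = (\<Prod>k = 1..n. qint q (int k))"

text \<open>The index set is the type \<^typ>\<open>4\<close>, whose arithmetic is that of the integers modulo 4.\<close>

definition weyl_rel :: "'a::field \<Rightarrow> 4 \<Rightarrow> (4, 'a) free_alg"
  where "weyl_rel q i =
    const (inverse (q - inverse q)) *
      (const q * gen i * gen (i + 1) - const (inverse q) * gen (i + 1) * gen i) - 1"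

definition serre_rel :: "'a::field \<Rightarrow> 4 \<Rightarrow> (4, 'a) free_alg"
  where "serre_rel q i =
      gen i ^ 3 * gen (i + 2)
    - const (qint q 3) * gen i ^ 2 * gen (i + 2) * gen i
    + const (qint q 3) * gen i * gen (i + 2) * gen i ^ 2
    - gen (i + 2) * gen i ^ 3"

definition box_ideal :: "'a::field \<Rightarrow> (4, 'a) free_alg set"
  where "box_ideal q = genideal free_ring (range (weyl_rel q) \<union> range (serre_rel q))"

definition box :: "'a::field \<Rightarrow> (4, 'a) free_alg set ring"
  where "box q = free_ring Quot box_ideal q"

definition box_class :: "'a::field \<Rightarrow> (4, 'a) free_alg \<Rightarrow> (4, 'a) free_alg set"
  where "box_class q p = box_ideal q +>\<^bsub>free_ring\<^esub> p"

definition box_x :: "'a::field \<Rightarrow> 4 \<Rightarrow> (4, 'a) free_alg set"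
  where "box_x q i = box_class q (gen i)"

text \<open>\<open>box_n q i\<close> is the element \<open>\<nn>\<^bsub>i,i+1\<^esub>\<close>.\<close>

definition box_n :: "'a::field \<Rightarrow> 4 \<Rightarrow> (4, 'a) free_alg set"
  where "box_n q i = box_class q (const (q / (q - inverse q)) * (1 - gen i * gen (i + 1)))"

lemma box_ideal_ideal: "ideal (box_ideal q) free_ring"
  unfolding box_ideal_def
  by (rule ring.genideal_ideal[OF ring_free_ring]) simp

lemma box_ring: "ring (box q)"
  unfolding box_def by (rule ideal.quotient_is_ring[OF box_ideal_ideal])

lemma box_class_hom: "box_class q \<in> ring_hom free_ring (box q)"
  unfolding box_def box_class_def[abs_def]
  by (rule ideal.rcos_ring_hom[OF box_ideal_ideal])

lemma box_n_alt:
  assumes "q - inverse q \<noteq> 0"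
  shows "box_n q i =
    box_class q (const (inverse q / (q - inverse q)) * (1 - gen (i + 1) * gen i))"
    (is "_ = box_class q ?B")
proof -
  let ?d = "q - inverse q"
  let ?A = "const (q / ?d) * (1 - gen i * gen (i + 1)) :: (4, 'a) free_alg"
  let ?W = "weyl_rel q i"
  have W: "?W \<in> box_ideal q"
    unfolding box_ideal_def
    using ring.genideal_self[OF ring_free_ring, of "range (weyl_rel q) \<union> range (serre_rel q)"]
    by auto
  have "const (q / ?d) - const (inverse q / ?d) = (1 :: (4, 'a) free_alg)"
    using assms by (simp flip: const_diff diff_divide_distrib add: const_one)
  moreover have "?W = const (q / ?d) * (gen i * gen (i + 1))
      - const (inverse q / ?d) * (gen (i + 1) * gen i) - 1"
    by (simp add: weyl_rel_def right_diff_distrib divide_inverse mult.commute[of _ "inverse ?d"]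
        const_mult mult.assoc)
  ultimately have "?B = ?W + ?A"
    by (simp add: algebra_simps)
  then have "?B = ?W \<oplus>\<^bsub>free_ring\<^esub> ?A"
    by (simp add: ring_of_type_algebra_def)
  then have "?B \<in> box_ideal q +>\<^bsub>free_ring\<^esub> ?A"
    using W by (auto simp: a_r_coset_def')
  then show ?thesis
    unfolding box_n_def box_class_def
    by (rule abelian_group.a_repr_independence[OF ring.is_abelian_group[OF ring_free_ring] _ _
          additive_subgroup.a_subgroup[OF ideal.axioms(1)[OF box_ideal_ideal]]]) simp
qed


section \<open>Modules\<close>

definition End_ring :: "('a::field \<Rightarrow> 'v::ab_group_add \<Rightarrow> 'v) \<Rightarrow> ('v \<Rightarrow> 'v) ring"
  where "End_ring scale =
    \<lparr> carrier = {f. Vector_Spaces.linear scale scale f},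
      monoid.mult = (\<lambda>f g. f \<circ> g), one = id,
      ring.zero = (\<lambda>v. 0), add = (\<lambda>f g v. f v + g v) \<rparr>"

lemma End_ring_ring:
  assumes "vector_space scale"
  shows "ring (End_ring scale)"
proof -
  interpret vector_space scale by fact
  interpret vector_space_pair scale scale ..
  have neg: "Vector_Spaces.linear scale scale (\<lambda>v. - f v)"
    if "Vector_Spaces.linear scale scale f" for f
    using that by (rule linear_compose_neg)
  show ?thesis
  proof (rule ringI)
    show "abelian_group (End_ring scale)"
    proof (rule abelian_groupI)
      fix f assume "f \<in> carrier (End_ring scale)"
      then show "\<exists>g \<in> carrier (End_ring scale). g \<oplus>\<^bsub>End_ring scale\<^esub> f = \<zero>\<^bsub>End_ring scale\<^esub>"
        by (intro bexI[of _ "\<lambda>v. - f v"]) (auto simp: End_ring_def neg)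
    qed (auto simp: End_ring_def linear_compose_add linear_zero algebra_simps)
    show "Group.monoid (End_ring scale)"
      by (rule monoidI) (auto simp: End_ring_def linear_id intro: Vector_Spaces.linear_compose)
  qed (auto simp: End_ring_def linear_add)
qed

text \<open>
  A \<open>\<square>\<^sub>q\<close>-module structure on a vector space is a homomorphism of unital
  algebras from \<open>\<square>\<^sub>q\<close> to the endomorphisms; the last
  clause expresses linearity over the ground field.
\<close>

definition box_module ::
    "'a::field \<Rightarrow> ('a \<Rightarrow> 'v::ab_group_add \<Rightarrow> 'v) \<Rightarrow> ((4, 'a) free_alg set \<Rightarrow> 'v \<Rightarrow> 'v) \<Rightarrow> bool"
  where "box_module q scale \<rho> \<longleftrightarrow>
    vector_space scale \<and>
    \<rho> \<in> ring_hom (box q) (End_ring scale) \<and>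
    (\<forall>c. \<rho> (box_class q (const c)) = scale c)"

text \<open>
  \<^const>\<open>Sum_any\<close> sums the nonzero terms; for nilpotent \<open>\<psi>\<close> there are only finitely many.
\<close>

definition exp_q :: "'a::field \<Rightarrow> ('a \<Rightarrow> 'v::ab_group_add \<Rightarrow> 'v) \<Rightarrow> ('v \<Rightarrow> 'v) \<Rightarrow> 'v \<Rightarrow> 'v"
  where "exp_q q scale \<psi> v =
    Sum_any (\<lambda>n. scale (q ^ (n choose 2) / qfact q n) ((\<psi> ^^ n) v))"

end

theory Submission
  imports Defs
begin

text \<open>
  Write \<open>A\<close>, \<open>B\<close> and \<open>N\<close> for the actions of \<open>x\<^bsub>i\<^esub>\<close>, \<open>x\<^bsub>i+1\<^esub>\<close> and
  \<open>\<nn>\<^bsub>i,i+1\<^esub>\<close>, and \<open>E\<close> for \<open>exp\<^sub>q(N)\<close>. Once \<open>A\<close>, \<open>B\<close> and \<open>E\<close> are known to be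
  invertible, both claims are rearrangements of the single identity \<open>B E A = E\<close>
  (\<open>conjugation_of_factored_unit\<close>).

  To see that identity, expand \<open>A B A\<close> in two ways with \<open>B A = 1 - (q\<^sup>2 - 1) N\<close> and
  \<open>A B = 1 - (1 - q\<^sup>-\<^sup>2) N\<close>; this gives \<open>N A = q\<^sup>2 A N\<close>. Moving \<open>A\<close> to the left through \<open>E\<close>
  therefore turns \<open>E\<close> into \<open>exp\<^sub>q(q\<^sup>2 N)\<close>, so that
  \<open>B E A = (1 - (q\<^sup>2 - 1) N) exp\<^sub>q(q\<^sup>2 N)\<close>, and the right-hand side equals \<open>exp\<^sub>q(N)\<close> by the
  functional equation of the \<open>q\<close>-exponential (\<open>B_E_A\<close>).

  Invertibility rests on finite dimension. If \<open>A v = 0\<close> with \<open>v \<noteq> 0\<close>, then \<open>v\<close> is an eigenvector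
  of \<open>N\<close>, and \<open>B\<close> produces from it eigenvectors for infinitely many eigenvalues, which is absurd
  (\<open>inj_A\<close>). Hence \<open>A\<close> is invertible and conjugates \<open>N\<close> to a multiple of itself by
  \<open>q\<^sup>2\<close>; since no positive power of \<open>q\<^sup>2\<close> is \<open>1\<close>, the minimal polynomial of \<open>N\<close> has to be a
  power of the indeterminate, so \<open>N\<close> is nilpotent (\<open>nilpotent_if_similar_to_multiple\<close>).
  Consequently \<open>A B\<close> and \<open>E\<close>, which differ from the identity by nilpotents, are invertible too.
\<close>

section \<open>Polynomials in an endomorphism\<close>

text \<open>
  The Horner form makes the value at a constructor \<open>pCons\<close> hold without a side condition, so that
  the calculus of polynomials in \<open>f\<close> follows by induction on the polynomial.
\<close>

definition poly_app ::
    "('a::field \<Rightarrow> 'v::ab_group_add \<Rightarrow> 'v) \<Rightarrow> ('v \<Rightarrow> 'v) \<Rightarrow> 'a poly \<Rightarrow> 'v \<Rightarrow> 'v"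
  where "poly_app scale f p v = fold_coeffs (\<lambda>a w. scale a v + f w) p 0"

locale endomorphism = finite_dimensional_vector_space scale Basis
  for scale :: "'a::field \<Rightarrow> 'v::ab_group_add \<Rightarrow> 'v" and Basis +
  fixes f :: "'v \<Rightarrow> 'v"
  assumes linear: "Vector_Spaces.linear scale scale f"
begin

sublocale lin: Vector_Spaces.linear scale scale f
  by (rule linear)

abbreviation app :: "'a poly \<Rightarrow> 'v \<Rightarrow> 'v"
  where "app \<equiv> poly_app scale f"

lemma app_zero_poly: "app 0 v = 0"
  by (simp add: poly_app_def)

lemma app_pCons: "app (pCons a p) v = scale a v + f (app p v)"
  by (cases "p = 0 \<and> a = 0") (auto simp: poly_app_def lin.zero)

lemma app_add: "app (p + r) v = app p v + app r v"
  by (induction p r rule: poly_induct2)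
    (simp_all add: app_zero_poly app_pCons lin.add scale_left_distrib add_ac)

lemma app_smult: "app (smult c p) v = scale c (app p v)"
  by (induction p) (simp_all add: app_zero_poly app_pCons lin.scale scale_right_distrib)

lemma app_mult: "app (p * r) v = app p (app r v)"
  by (induction p) (simp_all add: app_zero_poly app_pCons app_add app_smult)

lemma app_diff: "app (p - r) v = app p v - app r v"
  using app_add[of "p - r" r v] by (simp add: algebra_simps)

lemma app_sum: "app (sum p A) v = (\<Sum>k\<in>A. app (p k) v)"
  by (induction A rule: infinite_finite_induct) (simp_all add: app_zero_poly app_add)

lemma app_monom: "app (monom a k) v = scale a ((f ^^ k) v)"
  by (induction k) (simp_all add: monom_0 monom_Suc app_zero_poly app_pCons lin.zero lin.scale)

lemma linear_app: "Vector_Spaces.linear scale scale (app p)"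
proof (induction p)
  case 0
  show ?case
    by unfold_locales (simp_all add: app_zero_poly)
next
  case (pCons a p)
  interpret p: Vector_Spaces.linear scale scale "app p"
    by (rule pCons)
  show ?case
    by unfold_locales
      (simp_all add: app_pCons p.add p.scale lin.add lin.scale scale_right_distrib scale_left_commute add_ac)
qed

lemma app_zero_vector: "app p 0 = 0"
  by (induction p) (simp_all add: app_zero_poly app_pCons lin.zero)

lemma app_eigenvector:
  assumes "f v = scale a v"
  shows "app p v = scale (poly p a) v"
  by (induction p) (simp_all add: app_zero_poly app_pCons assms lin.scale scale_left_distrib mult.commute)

text \<open>
  In finite dimension the powers \<open>f\<^sup>k v\<close> either repeat or form an infinite, hence linearly dependent,
  set; either way a linear relation between them is a polynomial that kills \<open>v\<close>.
\<close>

lemma annihilator_of_vector: "\<exists>p. p \<noteq> 0 \<and> app p v = 0"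
proof (cases "inj (\<lambda>k. (f ^^ k) v)")
  case False
  then obtain j k where jk: "j \<noteq> k" "(f ^^ j) v = (f ^^ k) v"
    by (auto simp: inj_def)
  let ?p = "monom 1 j - monom 1 k :: 'a poly"
  have "coeff ?p j \<noteq> 0"
    using jk(1) by simp
  then have "?p \<noteq> 0"
    by (metis coeff_0)
  moreover have "app ?p v = 0"
    using jk(2) by (simp add: app_diff app_monom)
  ultimately show ?thesis
    by blast
next
  case True
  let ?g = "\<lambda>k. (f ^^ k) v"
  have "infinite (range ?g)"
    using True by (rule range_inj_infinite)
  then have "dependent (range ?g)"
    using finiteI_independent by blast
  then obtain T u w where T: "finite T" "T \<subseteq> range ?g" "(\<Sum>w\<in>T. scale (u w) w) = 0"
      "w \<in> T" "u w \<noteq> 0"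
    unfolding dependent_explicit by blast
  then obtain I where I: "finite I" "T = ?g ` I"
    by (meson finite_subset_image)
  then obtain k where k: "k \<in> I" "u (?g k) \<noteq> 0"
    using T by blast
  let ?p = "\<Sum>k\<in>I. monom (u (?g k)) k"
  have "coeff ?p k = u (?g k)"
    using I(1) k(1) by (simp add: coeff_sum)
  then have "?p \<noteq> 0"
    using k(2) by (metis coeff_0)
  moreover have "app ?p v = (\<Sum>k\<in>I. scale (u (?g k)) (?g k))"
    by (simp add: app_sum app_monom)
  moreover have "\<dots> = (\<Sum>w\<in>T. scale (u w) w)"
    unfolding I(2) by (rule sum.reindex[symmetric, unfolded o_def]) (rule inj_on_subset[OF True], simp)
  ultimately show ?thesis
    using T(3) by metis
qed

text \<open>The product of annihilators of the basis vectors annihilates the whole space.\<close>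

lemma annihilator: "\<exists>p. p \<noteq> 0 \<and> (\<forall>v. app p v = 0)"
proof -
  interpret P: vector_space_pair scale scale ..
  obtain a where a: "\<And>v. a v \<noteq> 0" "\<And>v. app (a v) v = 0"
    using annihilator_of_vector by metis
  define p where "p = prod a Basis"
  have "app p v = 0" if "v \<in> Basis" for v
  proof -
    have "p = prod a (Basis - {v}) * a v"
      using that finite_Basis by (simp add: p_def prod.remove mult.commute)
    then show ?thesis
      by (simp add: app_mult a app_zero_vector)
  qed
  then have "app p v = 0" for v
    using P.linear_eq_on[OF linear_app[of p] linear_app[of 0], of v Basis] span_Basis
    by (simp add: app_zero_poly)
  moreover have "p \<noteq> 0"
    by (simp add: p_def a finite_Basis)
  ultimately show ?thesis
    by blast
qed

text \<open>Every eigenvalue is a root of an annihilating polynomial.\<close>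

lemma finite_spectrum: "finite {a. \<exists>v. v \<noteq> 0 \<and> f v = scale a v}"
proof -
  obtain p where p: "p \<noteq> 0" "\<And>v. app p v = 0"
    using annihilator by blast
  have "{a. \<exists>v. v \<noteq> 0 \<and> f v = scale a v} \<subseteq> {a. poly p a = 0}"
  proof clarify
    fix a v assume v: "v \<noteq> 0" "f v = scale a v"
    have "scale (poly p a) v = 0"
      using app_eigenvector[OF v(2), of p] p(2) by simp
    then show "poly p a = 0"
      using v(1) by simp
  qed
  then show ?thesis
    using poly_roots_finite[OF p(1)] finite_subset by blast
qed

lemma app_twist:
  assumes "\<And>v. f (g v) = scale c (g (f v))" "Vector_Spaces.linear scale scale g"
  shows "app p (g v) = g (app (pcompose p [:0, c:]) v)"
proof -
  interpret g: Vector_Spaces.linear scale scale g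
    by fact
  show ?thesis
    by (induction p)
      (simp_all add: app_zero_poly app_pCons app_add app_smult pcompose_pCons g.zero g.add g.scale lin.scale assms(1))
qed

text \<open>
  If \<open>p(t)\<close> is an annihilating polynomial of least degree \<open>d\<close>, then \<open>p(c t)\<close> annihilates as well,
  because \<open>g\<close> conjugates \<open>f\<close> to \<open>c f\<close>. The combination \<open>p(c t) - c\<^sup>d p(t)\<close> has smaller degree and
  must vanish; comparing coefficients leaves only the term \<open>t\<^sup>d\<close>, as the powers of \<open>c\<close> are distinct.
\<close>

lemma nilpotent_if_similar_to_multiple:
  assumes twist: "\<And>v. f (g v) = scale c (g (f v))"
    and g: "Vector_Spaces.linear scale scale g" "inj g"
    and c: "c \<noteq> 0" "\<And>n. n > 0 \<Longrightarrow> c ^ n \<noteq> 1"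
  shows "\<exists>d. \<forall>v. (f ^^ d) v = 0"
proof -
  interpret g: Vector_Spaces.linear scale scale g
    by fact
  let ?ann = "\<lambda>p. p \<noteq> 0 \<and> (\<forall>v. app p v = 0)"
  obtain p where p: "p \<noteq> 0" "\<And>v. app p v = 0"
    and least: "\<And>r. ?ann r \<Longrightarrow> degree p \<le> degree r"
    using ex_has_least_nat[of ?ann _ degree] annihilator by metis
  define d where "d = degree p"
  let ?r = "pcompose p [:0, c:] - smult (c ^ d) p"
  have "g (app (pcompose p [:0, c:]) v) = g 0" for v
    using app_twist[OF twist g(1), of p v] p(2) by (simp add: g.zero)
  then have "app (pcompose p [:0, c:]) v = 0" for v
    using g(2) by (meson injD)
  then have ann: "app ?r v = 0" for v
    by (simp add: app_diff app_smult p(2))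
  have "degree ?r \<le> d"
    unfolding d_def by (intro degree_diff_le) (auto simp: degree_pcompose)
  moreover have "coeff ?r d = 0"
    by (simp add: coeff_pcompose_linear)
  ultimately have r0: "?r = 0"
    using eq_zero_or_degree_less[of ?r d] least[of ?r] ann unfolding d_def by force
  have "coeff p k = 0" if "k \<noteq> d" for k
  proof (cases "k < d")
    case True
    have "coeff ?r k = 0"
      by (simp only: r0 coeff_0)
    then have "(c ^ k - c ^ d) * coeff p k = 0"
      by (simp add: coeff_pcompose_linear algebra_simps)
    moreover have "c ^ k \<noteq> c ^ d"
    proof
      assume "c ^ k = c ^ d"
      also have "\<dots> = c ^ k * c ^ (d - k)"
        using True by (simp flip: power_add)
      finally show False
        using c True by simp
    qed
    ultimately show ?thesis
      by simp
  next
    case False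
    then show ?thesis
      using that by (simp add: d_def coeff_eq_0)
  qed
  then have "p = monom (coeff p d) d"
    by (intro poly_eqI) auto
  then have "scale (coeff p d) ((f ^^ d) v) = 0" for v
    using p(2)[of v] app_monom by metis
  moreover have "coeff p d \<noteq> 0"
    using p(1) by (simp add: d_def)
  ultimately show ?thesis
    by auto
qed

end


section \<open>The relation between two consecutive generators\<close>

text \<open>The maps \<open>A\<close> and \<open>B\<close> abstract the actions of two consecutive generators.\<close>

locale q_weyl_module = finite_dimensional_vector_space scale Basis
  for scale :: "'a::field \<Rightarrow> 'v::ab_group_add \<Rightarrow> 'v" and Basis +
  fixes q :: 'a and A B :: "'v \<Rightarrow> 'v"
  assumes q0: "q \<noteq> 0"
    and q_not_root: "\<And>n. n > 0 \<Longrightarrow> q ^ n \<noteq> 1"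
    and linA: "Vector_Spaces.linear scale scale A"
    and linB: "Vector_Spaces.linear scale scale B"
    and weyl: "\<And>v. scale q (A (B v)) - scale (inverse q) (B (A v)) = scale (q - inverse q) v"
begin

sublocale A: Vector_Spaces.linear scale scale A
  by (rule linA)

sublocale B: Vector_Spaces.linear scale scale B
  by (rule linB)

definition N :: "'v \<Rightarrow> 'v"
  where "N v = scale (q / (q - inverse q)) (v - A (B v))"

lemma q_square_minus_1: "q\<^sup>2 - 1 \<noteq> 0"
  using q_not_root[of 2] by simp

lemma q_diff: "q - inverse q \<noteq> 0"
  using q_square_minus_1 q0 by (auto simp: field_simps power2_eq_square)

lemma AB_eq: "A (B v) = v - scale ((q\<^sup>2 - 1) / q\<^sup>2) (N v)"
proof -
  have "(q\<^sup>2 - 1) / q\<^sup>2 * (q / (q - inverse q)) = 1"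
    using q0 q_square_minus_1 q_diff by (simp add: field_simps power2_eq_square)
  then show ?thesis
    by (simp add: N_def)
qed

lemma BA_eq: "B (A v) = v - scale (q\<^sup>2 - 1) (N v)"
proof -
  have "scale (inverse q) (B (A v)) = scale q (A (B v)) - scale (q - inverse q) v"
    using weyl[of v] by (simp add: algebra_simps)
  then have "scale q (scale (inverse q) (B (A v))) =
      scale q (scale q (A (B v)) - scale (q - inverse q) v)"
    by simp
  then have "B (A v) = scale (q * q) (A (B v)) - scale (q * q - 1) v"
    using q0 by (simp add: scale_right_diff_distrib right_diff_distrib)
  also have "\<dots> = v - scale (q * q * ((q\<^sup>2 - 1) / q\<^sup>2)) (N v)"
    by (simp add: AB_eq algebra_simps)
  also have "q * q * ((q\<^sup>2 - 1) / q\<^sup>2) = q\<^sup>2 - 1"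
    using q0 by (simp add: power2_eq_square)
  finally show ?thesis .
qed

text \<open>
  Associativity of \<open>A B A\<close>, with \<open>A B\<close> and \<open>B A\<close> both expressed through \<open>N\<close>; the next lemma
  is the same for \<open>B A B\<close>.
\<close>

lemma N_A: "N (A v) = scale (q\<^sup>2) (A (N v))"
proof -
  let ?c = "(q\<^sup>2 - 1) / q\<^sup>2"
  have "scale ?c (N (A v)) = A v - A (B (A v))"
    by (simp add: AB_eq)
  also have "\<dots> = scale (q\<^sup>2 - 1) (A (N v))"
    by (simp add: BA_eq A.diff A.scale)
  also have "\<dots> = scale ?c (scale (q\<^sup>2) (A (N v)))"
    using q0 by simp
  finally have "scale ?c (N (A v)) = scale ?c (scale (q\<^sup>2) (A (N v)))" .
  moreover have "?c \<noteq> 0"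
    using q0 q_square_minus_1 by simp
  ultimately show ?thesis
    using scale_left_imp_eq by blast
qed

lemma N_B: "scale (q\<^sup>2) (N (B v)) = B (N v)"
proof -
  let ?c = "(q\<^sup>2 - 1) / q\<^sup>2"
  have "scale ?c (scale (q\<^sup>2) (N (B v))) = scale (q\<^sup>2 - 1) (N (B v))"
    using q0 by simp
  also have "\<dots> = B v - B (A (B v))"
    by (simp add: BA_eq)
  also have "\<dots> = scale ?c (B (N v))"
    by (simp add: AB_eq B.diff B.scale)
  finally have "scale ?c (scale (q\<^sup>2) (N (B v))) = scale ?c (B (N v))" .
  moreover have "?c \<noteq> 0"
    using q0 q_square_minus_1 by simp
  ultimately show ?thesis
    using scale_left_imp_eq by blast
qed

sublocale N: endomorphism scale Basis N
proof unfold_locales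
  show "N (u + v) = N u + N v" for u v
    by (simp add: N_def A.add B.add algebra_simps)
  show "N (scale c v) = scale c (N v)" for c v
    by (simp add: N_def A.scale B.scale algebra_simps)
qed

text \<open>
  On the kernel of \<open>A\<close> the relation for \<open>B A\<close> makes \<open>N\<close> the scalar \<open>1 / (q\<^sup>2 - 1)\<close>. By \<open>N_B\<close>, applying
  \<open>B\<close> divides an eigenvalue of \<open>N\<close> by \<open>q\<^sup>2\<close>. This chain of eigenvectors never reaches zero: an
  eigenvector killed by \<open>B\<close> must, by the relation for \<open>A B\<close>, have eigenvalue \<open>q\<^sup>2 / (q\<^sup>2 - 1)\<close>,
  which could only equal \<open>q\<^sup>-\<^sup>2\<^sup>m / (q\<^sup>2 - 1)\<close> if \<open>q\<close> were a root of unity. So \<open>N\<close> would have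
  infinitely many eigenvalues.
\<close>

lemma inj_A: "inj A"
  unfolding A.inj_iff_eq_0
proof (intro allI impI)
  fix v assume v: "A v = 0"
  show "v = 0"
  proof (rule ccontr)
    assume "v \<noteq> 0"
    let ?w = "\<lambda>m. (B ^^ m) v"
    \<comment> \<open>The eigenvalue of \<open>N\<close> at the vector \<open>B\<^sup>m v\<close>.\<close>
    define a where "a m = inverse ((q\<^sup>2 - 1) * q ^ (2 * m))" for m
    have a_Suc: "a m = q\<^sup>2 * a (Suc m)" for m
      using q0 q_square_minus_1 by (simp add: a_def field_simps power2_eq_square)
    have eig: "N (?w m) = scale (a m) (?w m)" for m
    proof (induction m)
      case 0
      have "v = scale (q\<^sup>2 - 1) (N v)"
        using BA_eq[of v] by (simp add: v B.zero)
      then have "scale (a 0) v = scale (a 0) (scale (q\<^sup>2 - 1) (N v))"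
        by simp
      then show ?case
        using q_square_minus_1 by (simp add: a_def)
    next
      case (Suc m)
      have "scale (q\<^sup>2) (N (?w (Suc m))) = scale (a m) (?w (Suc m))"
        by (simp add: N_B Suc B.scale)
      also have "\<dots> = scale (q\<^sup>2) (scale (a (Suc m)) (?w (Suc m)))"
        by (simp only: a_Suc[of m] scale_scale)
      finally show ?case
        by (rule scale_left_imp_eq[rotated]) (use q0 in simp)
    qed
    have nz: "?w m \<noteq> 0" for m
    proof (induction m)
      case 0
      then show ?case
        using \<open>v \<noteq> 0\<close> by simp
    next
      case (Suc m)
      show ?case
      proof
        assume "?w (Suc m) = 0"
        then have "?w m = scale ((q\<^sup>2 - 1) / q\<^sup>2 * a m) (?w m)"
          using AB_eq[of "?w m"] by (simp add: A.zero eig)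
        then have "scale (1 - (q\<^sup>2 - 1) / q\<^sup>2 * a m) (?w m) = 0"
          by (simp add: scale_left_diff_distrib)
        then have "(q\<^sup>2 - 1) / q\<^sup>2 * a m = 1"
          using Suc by simp
        moreover have cancel: "d / s * inverse (d * t) = inverse (s * t)" if "d \<noteq> 0" for d s t :: 'a
          using that by (simp add: field_simps)
        have "(q\<^sup>2 - 1) / q\<^sup>2 * a m = inverse (q ^ (2 + 2 * m))"
          unfolding a_def power_add by (rule cancel[OF q_square_minus_1])
        ultimately have "q ^ (2 + 2 * m) = 1"
          by (metis inverse_eq_1_iff)
        then show False
          using q_not_root[of "2 + 2 * m"] by simp
      qed
    qed
    have lt: "a m \<noteq> a n" if "m < n" for m n
    proof
      assume "a m = a n"
      then have "q ^ (2 * m) = q ^ (2 * n)"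
        using q_square_minus_1 by (simp add: a_def)
      also have "\<dots> = q ^ (2 * m) * q ^ (2 * (n - m))"
        using that by (simp flip: power_add distrib_left)
      finally have "q ^ (2 * (n - m)) = 1"
        using q0 by simp
      then show False
        using q_not_root[of "2 * (n - m)"] that by simp
    qed
    then have "inj a"
      by (intro injI) (metis linorder_neqE_nat)
    moreover have "range a \<subseteq> {b. \<exists>w. w \<noteq> 0 \<and> N w = scale b w}"
      using eig nz by blast
    ultimately show False
      using N.finite_spectrum range_inj_infinite finite_subset by blast
  qed
qed

lemma N_nilpotent: "\<exists>d. \<forall>v. (N ^^ d) v = 0"
proof (rule N.nilpotent_if_similar_to_multiple[OF N_A linA inj_A])
  show "(q\<^sup>2) ^ n \<noteq> 1" if "n > 0" for n
    using that q_not_root[of "2 * n"] by (simp add: power_mult)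
qed (use q0 in simp)

lemma N_pow_stable:
  assumes "(N ^^ d) v = 0" "d \<le> k"
  shows "(N ^^ k) v = 0"
  using assms(2,1) by (induction k rule: dec_induct) (simp_all add: N.lin.zero)

lemma bij_A: "bij A"
  using inj_A linear_inj_imp_surj[OF linA] by (simp add: bij_def)

text \<open>
  A vector killed by \<open>B\<close> is killed by \<open>A B\<close>, hence fixed by a multiple of the nilpotent map \<open>N\<close>.
\<close>

lemma bij_B: "bij B"
proof -
  obtain d where d: "\<And>v. (N ^^ d) v = 0"
    using N_nilpotent by blast
  have "inj B"
    unfolding B.inj_iff_eq_0
  proof (intro allI impI)
    fix u assume u: "B u = 0"
    let ?c = "(q\<^sup>2 - 1) / q\<^sup>2"
    have fix_u: "u = scale ?c (N u)"
      using AB_eq[of u] by (simp add: u A.zero)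
    have "u = scale (?c ^ k) ((N ^^ k) u)" for k
    proof (induction k)
      case (Suc k)
      have "u = scale ?c (N (scale (?c ^ k) ((N ^^ k) u)))"
        using fix_u Suc by metis
      then show ?case
        by (simp add: N.lin.scale)
    qed simp
    from this[of d] show "u = 0"
      by (simp add: d)
  qed
  then show ?thesis
    using linear_inj_imp_surj[OF linB] by (simp add: bij_def)
qed


section \<open>The \<open>q\<close>-exponential\<close>

definition e :: "nat \<Rightarrow> 'a"
  where "e n = q ^ (n choose 2) / qfact q n"

abbreviation E :: "'v \<Rightarrow> 'v"
  where "E \<equiv> exp_q q scale N"

lemma e_0: "e 0 = 1"
  by (simp add: e_def qfact_def binomial_eq_0)

text \<open>
  In terms of power series, this is the functional equation
  \<open>(1 - (q\<^sup>2 - 1) t) exp\<^sub>q(q\<^sup>2 t) = exp\<^sub>q(t)\<close>, read off at the coefficient of \<open>t\<^sup>k\<^sup>+\<^sup>1\<close>.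
\<close>

lemma e_Suc: "e (Suc k) * (q ^ (2 * Suc k) - 1) = (q\<^sup>2 - 1) * q ^ (2 * k) * e k"
proof -
  let ?m = "Suc k"
  have nz: "q ^ (2 * ?m) - 1 \<noteq> 0"
    using q_not_root[of "2 * ?m"] by simp
  have "qint q (int ?m) = (q ^ ?m - inverse (q ^ ?m)) / (q - inverse q)"
    by (simp only: qint_def power_int_minus power_int_of_nat)
  also have "\<dots> = (q ^ (2 * ?m) - 1) / (q ^ k * (q\<^sup>2 - 1))"
  proof -
    have "q ^ (2 * ?m) = (q * q ^ k) * (q * q ^ k)"
      by (simp add: mult_2 power_add)
    then have "q ^ ?m - inverse (q ^ ?m) = (q ^ (2 * ?m) - 1) / (q * q ^ k)"
      using q0 by (simp add: diff_divide_distrib inverse_eq_divide)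
    moreover have "q - inverse q = (q\<^sup>2 - 1) / q"
      using q0 by (simp add: field_simps power2_eq_square)
    ultimately show ?thesis
      using q0 by simp
  qed
  finally have qi: "qint q (int ?m) = (q ^ (2 * ?m) - 1) / (q ^ k * (q\<^sup>2 - 1))" .
  have ch: "?m choose 2 = k + (k choose 2)"
    by (simp add: numeral_2_eq_2)
  have "e ?m = q ^ k / qint q (int ?m) * e k"
    by (simp add: e_def qfact_def ch power_add del: of_nat_Suc)
  then show ?thesis
    using nz q_square_minus_1 q0 unfolding qi by (simp add: mult_2 power_add)
qed

lemma E_eq_sum:
  assumes "(N ^^ d) v = 0"
  shows "E v = (\<Sum>k<d. scale (e k) ((N ^^ k) v))"
proof -
  have "{k. scale (e k) ((N ^^ k) v) \<noteq> 0} \<subseteq> {..<d}"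
    using N_pow_stable[OF assms] by (auto simp: not_less intro: ccontr)
  then show ?thesis
    unfolding exp_q_def e_def[symmetric] by (intro Sum_any.expand_superset) auto
qed

lemma E_eq_app: "\<exists>p. E = N.app p"
proof -
  obtain d where d: "\<And>v. (N ^^ d) v = 0"
    using N_nilpotent by blast
  have "E = N.app (\<Sum>k<d. monom (e k) k)"
    by (rule ext) (simp add: E_eq_sum[OF d] N.app_sum N.app_monom)
  then show ?thesis
    by blast
qed

lemma linear_E: "Vector_Spaces.linear scale scale E"
  using E_eq_app N.linear_app by metis

lemma E_N: "E (N v) = N (E v)"
proof -
  obtain p where p: "E = N.app p"
    using E_eq_app by blast
  have "N.app (monom 1 1) v = N v" for v
    by (simp add: N.app_monom)
  then show ?thesis
    unfolding p by (metis N.app_mult mult.commute)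
qed

text \<open>
  The constant term of \<open>E\<close> is \<open>1\<close>, so \<open>E\<close> fixes the kernel of \<open>N\<close>. A nonzero vector killed by \<open>E\<close>
  would have a last nonzero image under the powers of \<open>N\<close>, and this image would be both fixed and
  killed by \<open>E\<close>.
\<close>

lemma bij_E: "bij E"
proof -
  interpret E: Vector_Spaces.linear scale scale E
    by (rule linear_E)
  have E_pow: "E ((N ^^ k) v) = (N ^^ k) (E v)" for k v
    by (induction k) (simp_all add: E_N)
  have pow_0: "(N ^^ k) 0 = 0" for k
    by (induction k) (simp_all add: N.lin.zero)
  have "inj E"
    unfolding E.inj_iff_eq_0
  proof (intro allI impI)
    fix v assume v: "E v = 0"
    have "(N ^^ k) v = 0" if "(N ^^ Suc k) v = 0" for k
    proof -
      have "(N ^^ 1) ((N ^^ k) v) = 0"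
        using that by simp
      then have "E ((N ^^ k) v) = (N ^^ k) v"
        by (simp add: E_eq_sum[of 1] e_0 del: funpow.simps)
      then show ?thesis
        by (simp add: E_pow v pow_0)
    qed
    then have "(N ^^ k) v = 0 \<Longrightarrow> v = 0" for k
      by (induction k) auto
    then show "v = 0"
      using N_nilpotent by blast
  qed
  then show ?thesis
    using linear_inj_imp_surj[OF linear_E] by (simp add: bij_def)
qed

text \<open>
  Moving \<open>A\<close> past \<open>N\<^sup>k\<close> costs \<open>q\<^sup>2\<^sup>k\<close>, after which \<open>B A = 1 - (q\<^sup>2 - 1) N\<close> spreads each term over two
  adjacent powers of \<open>N\<close>. By \<open>e_Suc\<close> the deviation from the series of \<open>E\<close> telescopes to zero.
\<close>

lemma B_E_A: "B (E (A v)) = E v"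
proof -
  obtain d where d: "\<And>v. (N ^^ d) v = 0"
    using N_nilpotent by blast
  define b where "b k = scale (e k * (q ^ (2 * k) - 1)) ((N ^^ k) v)" for k
  have N_pow_A: "(N ^^ k) (A v) = scale (q ^ (2 * k)) (A ((N ^^ k) v))" for k
    by (induction k) (simp_all add: N.lin.scale N_A mult_ac power2_eq_square)
  have summand: "B (scale (e k) ((N ^^ k) (A v))) = scale (e k) ((N ^^ k) v) + (b k - b (Suc k))"
    for k
  proof -
    have "B (scale (e k) ((N ^^ k) (A v))) =
        scale (e k * q ^ (2 * k)) ((N ^^ k) v) -
        scale ((q\<^sup>2 - 1) * q ^ (2 * k) * e k) ((N ^^ Suc k) v)"
      by (simp add: N_pow_A B.scale BA_eq scale_right_diff_distrib mult_ac)
    also have "\<dots> = scale (e k) ((N ^^ k) v) + (b k - b (Suc k))"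
      unfolding e_Suc[symmetric] b_def
      by (simp add: right_diff_distrib scale_left_diff_distrib del: funpow.simps)
    finally show ?thesis .
  qed
  have "B (E (A v)) = (\<Sum>k<d. scale (e k) ((N ^^ k) v)) + (\<Sum>k<d. b k - b (Suc k))"
    by (simp only: E_eq_sum[OF d] B.sum summand sum.distrib)
  also have "(\<Sum>k<d. b k - b (Suc k)) = b 0 - b d"
    by (simp add: sum_lessThan_telescope')
  also have "b 0 - b d = 0"
    by (simp add: b_def d)
  finally show ?thesis
    by (simp add: E_eq_sum[OF d])
qed

end


section \<open>Conjugation in the endomorphism ring\<close>

lemma (in monoid) conjugation_of_factored_unit:
  assumes u: "x \<in> Units G" "y \<in> Units G" "e \<in> Units G" and eq: "y \<otimes> (e \<otimes> x) = e"
  shows "e \<otimes> x \<otimes> inv e = inv y" and "inv e \<otimes> y \<otimes> e = inv x"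
proof -
  note c = u[THEN Units_closed] u[THEN Units_inv_closed]
  have "inv y \<otimes> e = inv y \<otimes> (y \<otimes> (e \<otimes> x))"
    by (simp only: eq)
  also have "\<dots> = e \<otimes> x"
    using u c by (simp flip: m_assoc)
  finally have ex: "e \<otimes> x = inv y \<otimes> e" by simp
  show "e \<otimes> x \<otimes> inv e = inv y"
    unfolding ex using u c by (simp add: m_assoc)
  have "e \<otimes> inv x = y \<otimes> (e \<otimes> x) \<otimes> inv x"
    by (simp only: eq)
  also have "\<dots> = y \<otimes> e"
    using u c by (simp add: m_assoc)
  finally have ye: "y \<otimes> e = e \<otimes> inv x" by simp
  have "inv e \<otimes> y \<otimes> e = inv e \<otimes> (y \<otimes> e)"
    using c by (simp add: m_assoc)
  also have "\<dots> = inv x"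
    unfolding ye using u c by (simp flip: m_assoc)
  finally show "inv e \<otimes> y \<otimes> e = inv x" .
qed

lemma (in vector_space) bij_linear_in_Units:
  assumes "Vector_Spaces.linear scale scale f" "bij f"
  shows "f \<in> Units (End_ring scale)"
proof -
  interpret f: Vector_Spaces.linear scale scale f
    by fact
  let ?g = "inv_into UNIV f"
  have fg: "f (?g v) = v" and gf: "?g (f v) = v" for v
    using assms(2) by (simp_all add: bij_is_surj surj_f_inv_f bij_is_inj)
  have "Vector_Spaces.linear scale scale ?g"
  proof unfold_locales
    show "?g (u + v) = ?g u + ?g v" for u v
      by (metis f.add fg gf)
    show "?g (scale c v) = scale c (?g v)" for c v
      by (metis f.scale fg gf)
  qed
  then show ?thesis
    using assms(1) fg gf by (auto simp: Units_def End_ring_def fun_eq_iff intro!: bexI[of _ ?g])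
qed

text \<open>
  A module is a homomorphism on residue classes; composing it with the quotient map gives an action
  of the free algebra, in which the defining relations can be evaluated term by term.
\<close>

locale box_rep =
  fixes q :: "'a::field" and scale :: "'a \<Rightarrow> 'v::ab_group_add \<Rightarrow> 'v"
    and \<rho> :: "(4, 'a) free_alg set \<Rightarrow> 'v \<Rightarrow> 'v"
  assumes box_module: "box_module q scale \<rho>"
begin

definition act :: "(4, 'a) free_alg \<Rightarrow> 'v \<Rightarrow> 'v"
  where "act p = \<rho> (box_class q p)"

lemma act_hom: "act \<in> ring_hom free_ring (End_ring scale)"
proof -
  have "\<rho> \<in> ring_hom (box q) (End_ring scale)"
    using box_module by (simp add: box_module_def)
  from ring_hom_trans[OF box_class_hom this] show ?thesis
    by (simp add: act_def[abs_def] o_def)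
qed

lemma act_linear: "Vector_Spaces.linear scale scale (act p)"
  using ring_hom_closed[OF act_hom, of p] by (simp add: End_ring_def)

lemma act_add: "act (p + r) v = act p v + act r v"
  using ring_hom_add[OF act_hom, of p r] by (simp add: ring_of_type_algebra_def End_ring_def)

lemma act_mult: "act (p * r) v = act p (act r v)"
  using ring_hom_mult[OF act_hom, of p r] by (simp add: ring_of_type_algebra_def End_ring_def)

lemma act_one: "act 1 v = v"
  using ring_hom_one[OF act_hom] by (simp add: ring_of_type_algebra_def End_ring_def)

lemma act_diff: "act (p - r) v = act p v - act r v"
  using act_add[of "p - r" r v] by (simp add: algebra_simps)

lemma act_const: "act (const c) v = scale c v"
  using box_module by (simp add: act_def box_module_def)

lemma act_weyl_rel: "act (weyl_rel q i) v = 0"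
proof -
  have "weyl_rel q i \<in> box_ideal q"
    unfolding box_ideal_def
    using ring.genideal_self[OF ring_free_ring, of "range (weyl_rel q) \<union> range (serre_rel q)"]
    by auto
  then have "weyl_rel q i \<in> box_ideal q +>\<^bsub>free_ring\<^esub> 0"
    by (auto simp: a_r_coset_def' ring_of_type_algebra_def)
  then have "box_class q 0 = box_class q (weyl_rel q i)"
    unfolding box_class_def
    by (rule abelian_group.a_repr_independence[OF ring.is_abelian_group[OF ring_free_ring] _ _
          additive_subgroup.a_subgroup[OF ideal.axioms(1)[OF box_ideal_ideal]]]) simp
  then show ?thesis
    using act_diff[of 0 0 v] by (simp add: act_def)
qed

end

theorem theorem8p1:
  fixes q :: "'a::alg_closed_field"
    and scale :: "'a \<Rightarrow> 'v::ab_group_add \<Rightarrow> 'v"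
    and Basis :: "'v set"
    and \<rho> :: "(4, 'a) free_alg set \<Rightarrow> 'v \<Rightarrow> 'v"
    and i :: 4
  assumes "q \<noteq> 0"
    and "\<forall>n::nat. n > 0 \<longrightarrow> q ^ n \<noteq> 1"
    and "finite_dimensional_vector_space scale Basis"
    and "\<exists>v::'v. v \<noteq> 0"
    and "box_module q scale \<rho>"
  shows "exp_q q scale (\<rho> (box_n q i)) \<otimes>\<^bsub>End_ring scale\<^esub> \<rho> (box_x q i)
           \<otimes>\<^bsub>End_ring scale\<^esub> inv\<^bsub>End_ring scale\<^esub> (exp_q q scale (\<rho> (box_n q i)))
         = inv\<^bsub>End_ring scale\<^esub> (\<rho> (box_x q (i + 1)))
       \<and> inv\<^bsub>End_ring scale\<^esub> (exp_q q scale (\<rho> (box_n q i)))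
           \<otimes>\<^bsub>End_ring scale\<^esub> \<rho> (box_x q (i + 1))
           \<otimes>\<^bsub>End_ring scale\<^esub> exp_q q scale (\<rho> (box_n q i))
         = inv\<^bsub>End_ring scale\<^esub> (\<rho> (box_x q i))"
proof -
  interpret finite_dimensional_vector_space scale Basis
    by fact
  interpret box_rep q scale \<rho>
    by unfold_locales fact
  define A B where "A = act (gen i)" and "B = act (gen (i + 1))"
  have lin: "Vector_Spaces.linear scale scale A" "Vector_Spaces.linear scale scale B"
    by (simp_all add: A_def B_def act_linear)
  have d: "q - inverse q \<noteq> 0"
  proof
    assume "q - inverse q = 0"
    then have "q ^ 2 = 1"
      using assms(1) by (simp add: field_simps power2_eq_square)
    then show False
      using assms(2) by simp
  qed
  have weyl: "scale q (A (B v)) - scale (inverse q) (B (A v)) = scale (q - inverse q) v" for v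
  proof -
    have "scale (inverse (q - inverse q)) (scale q (A (B v)) - scale (inverse q) (B (A v))) = v"
      using act_weyl_rel[of i v]
      by (simp add: weyl_rel_def act_diff act_mult act_const act_one A_def B_def)
    then have "scale (q - inverse q) v = scale (q - inverse q)
        (scale (inverse (q - inverse q)) (scale q (A (B v)) - scale (inverse q) (B (A v))))"
      by simp
    also have "\<dots> = scale q (A (B v)) - scale (inverse q) (B (A v))"
      using right_inverse[OF d] by (simp only: scale_scale scale_one)
    finally show ?thesis by simp
  qed
  interpret q_weyl_module scale Basis q A B
    by unfold_locales (use assms lin weyl in \<open>auto simp: Vector_Spaces.linear_iff\<close>)
  have x: "\<rho> (box_x q i) = A" and y: "\<rho> (box_x q (i + 1)) = B"
    by (simp_all add: A_def B_def act_def box_x_def)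
  have n: "\<rho> (box_n q i) = N"
    by (rule ext)
      (simp add: box_n_def N_def act_mult act_const act_diff act_one
        flip: act_def A_def B_def)
  interpret R: ring "End_ring scale"
    by (rule End_ring_ring) unfold_locales
  have "B \<otimes>\<^bsub>End_ring scale\<^esub> (E \<otimes>\<^bsub>End_ring scale\<^esub> A) = E"
    by (simp add: End_ring_def fun_eq_iff B_E_A)
  from R.conjugation_of_factored_unit[OF bij_linear_in_Units[OF linA bij_A]
      bij_linear_in_Units[OF linB bij_B] bij_linear_in_Units[OF linear_E bij_E] this]
  show ?thesis
    unfolding x y n by simp
qed

end
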